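(* Assume that there exists a scalar $L>0$ such that $\Vert u_i\Vert<L$ for every $u_i\in\mathcal{U}_i$ and every $i\in I$. Then each isolated efficient solution of the problem $\min f(x)$ s.t. $x\in\Omega$ with constant $L$ is a highly robust strictly efficient solution of $(P_{\mathcal{U}})$.
   Context: Setting: $X$ is a real Banach space with dual $X^*$ and pairing $\langle\cdot,\cdot\rangle$; $p\ge 2$, $I=\{1,\dots,p\}$; $f=(f_1,\dots,f_p):X\to\mathbb{R}^p$; $\Omega\subseteq X$ is nonempty (the robust feasible set); $\mathcal{U}_i\subseteq X^*$, $i\in I$, are nonempty and $\mathcal{U}=\prod_{i=1}^p\mathcal{U}_i$. For $u\in\mathcal{U}$ put $f_i(x,u_i)=f_i(x)-\langle u_i,x\rangle$ and $f(x,u)=(f_1(x,u_1),\dots,f_p(x,u_p))$. $(P_u)$ is the problem of minimizing $f(x,u)$ over $x\in\Omega$, and $(P_{\mathcal{U}})$ is the family $(P_u)_{u\in\mathcal{U}}$. For $a,b\in\mathbb{R}^p$, $a\leqq b$ iff $a_i\le b_i$ for all $i\in I$. $\bar x\in\Omega$ is an isolated efficient solution of $\min f(x)$ s.t. $x\in\Omega$ with constant $L>0$ if $\max_{i\in I}\{f_i(x)-f_i(\bar x)\}\ge L\Vert x-\bar x\Vert$ for all $x\in\Omega$. $\bar x\in\Omega$ is a highly robust strictly efficient solution of $(P_{\mathcal{U}})$ if for every $u\in\mathcal{U}$ there is no $x\in\Omega\setminus\{\bar x\}$ with $f(x,u)\leqq f(\bar x,u)$. *)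

theory Defs
  imports "HOL-Analysis.Analysis"
begin

text \<open>
  The index set is a finite type \<open>'p\<close>; the dual of \<open>'a\<close> is \<open>'a \<Rightarrow>\<^sub>L real\<close> with its operator norm,
  and the pairing is application. The order \<open>\<le>\<close> on \<open>real ^ 'p\<close> is componentwise
  (\<open>less_eq_vec_def\<close>).
\<close>

definition perturbed_objective ::
  "('a::banach \<Rightarrow> real ^ 'p) \<Rightarrow> ('p \<Rightarrow> ('a \<Rightarrow>\<^sub>L real)) \<Rightarrow> 'a \<Rightarrow> real ^ 'p" where
  "perturbed_objective f u x = (\<chi> i. f x $ i - blinfun_apply (u i) x)"

definition isolated_efficient ::
  "('a::banach \<Rightarrow> real ^ 'p) \<Rightarrow> 'a set \<Rightarrow> real \<Rightarrow> 'a \<Rightarrow> bool" where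
  "isolated_efficient f \<Omega> L xbar \<longleftrightarrow>
     xbar \<in> \<Omega> \<and> L > 0 \<and>
     (\<forall>x\<in>\<Omega>. Max (range (\<lambda>i. f x $ i - f xbar $ i)) \<ge> L * norm (x - xbar))"

definition highly_robust_strictly_efficient ::
  "('a::banach \<Rightarrow> real ^ 'p) \<Rightarrow> 'a set \<Rightarrow> ('p \<Rightarrow> ('a \<Rightarrow>\<^sub>L real) set) \<Rightarrow> 'a \<Rightarrow> bool" where
  "highly_robust_strictly_efficient f \<Omega> U xbar \<longleftrightarrow>
     xbar \<in> \<Omega> \<and>
     (\<forall>u \<in> Pi UNIV U.
        \<not> (\<exists>x \<in> \<Omega> - {xbar}. perturbed_objective f u x \<le> perturbed_objective f u xbar))"

end

theory Submission
  imports Defs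
begin

text \<open>
  Moving from \<open>xbar\<close> to \<open>x\<close> changes a linear functional of norm less than \<open>L\<close> by strictly less
  than \<open>L * norm (x - xbar)\<close>. At an isolated efficient solution some component of the unperturbed
  objective rises by at least this amount, so no admissible perturbation can cancel the rise in
  that component.
\<close>

theorem theorem7:
  fixes f :: "'a::banach \<Rightarrow> real ^ 'p"
    and \<Omega> :: "'a set"
    and U :: "'p \<Rightarrow> ('a \<Rightarrow>\<^sub>L real) set"
    and L :: real
  assumes "CARD('p) \<ge> 2"
    and "\<Omega> \<noteq> {}"
    and "\<And>i. U i \<noteq> {}"
    and "L > 0"
    and "\<And>i v. v \<in> U i \<Longrightarrow> norm v < L"
  shows "\<forall>xbar. isolated_efficient f \<Omega> L xbar \<longrightarrow> highly_robust_strictly_efficient f \<Omega> U xbar"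
proof (intro allI impI)
  fix xbar
  assume iso: "isolated_efficient f \<Omega> L xbar"
  have "\<not> perturbed_objective f u x \<le> perturbed_objective f u xbar"
    if u: "u \<in> Pi UNIV U" and x: "x \<in> \<Omega> - {xbar}" for u x
  proof
    assume le: "perturbed_objective f u x \<le> perturbed_objective f u xbar"
    have "Max (range (\<lambda>i. f x $ i - f xbar $ i)) \<in> range (\<lambda>i. f x $ i - f xbar $ i)"
      by (rule Max_in) auto
    then obtain i where "Max (range (\<lambda>i. f x $ i - f xbar $ i)) = f x $ i - f xbar $ i"
      by blast
    then have "L * norm (x - xbar) \<le> f x $ i - f xbar $ i"
      using iso x by (auto simp: isolated_efficient_def)
    also have "\<dots> \<le> blinfun_apply (u i) (x - xbar)"
      using le by (simp add: less_eq_vec_def perturbed_objective_def blinfun.diff_right algebra_simps)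
    also have "\<dots> \<le> norm (u i) * norm (x - xbar)"
      using norm_blinfun[of "u i" "x - xbar"] by simp
    also have "\<dots> < L * norm (x - xbar)"
      using assms(5)[of "u i" i] u x by (intro mult_strict_right_mono) auto
    finally show False by simp
  qed
  then show "highly_robust_strictly_efficient f \<Omega> U xbar"
    using iso by (auto simp: highly_robust_strictly_efficient_def isolated_efficient_def)
qed

end
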